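(* Let $R$ be a principal ideal semidomain, $S$ a multiplicative subset of $R$, and $A$ an ideal of $R$. The following statements are equivalent: (1) $A$ is an $S$-primary ideal of $R$. (2) $A=(vp^n)$ for some $n\in\mathbb N$, some $p\in\mathbf P\setminus\mathbf P_S$, and some $v\in R$ such that $(v)\cap S\neq\varnothing$.
   Context: Semirings are commutative with unity $1$ and zero $0$. A semidomain is a semiring (with $1\ne 0$) in which $ab=ac$ with $a\neq 0$ implies $b=c$. A principal ideal semidomain is a semidomain in which every ideal is of the form $(a)=\{ra: r\in R\}$ for some $a\in R$. A multiplicative subset of $R$ is a nonempty subset $S\subsetneq R$ with $1\in S$ and $s_1s_2\in S$ for all $s_1,s_2\in S$. $\mathbb N$ denotes the positive integers. $\mathbf P$ denotes the set of all irreducible (prime) elements of $R$, and $\mathbf P_S=\{p\in\mathbf P: (p)\cap S\neq\varnothing\}$. The radical of an ideal $I$ is $\sqrt I=\{x\in R: x^n\in I \text{ for some } n\in\mathbb N\}$. An ideal $A$ with $A\cap S=\varnothing$ is $S$-primary if there exists $s\in S$ such that for all $a,b\in R$, $ab\in A$ implies $sa\in A$ or $sb\in\sqrt A$.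
   Formalization: The ideal A is assumed to be nonzero; for A = {0} and 0 not in S (e.g. R the integers, S = {1}) the ideal A is S-primary but is not of the form (vp^n) as in (2), so the equivalence fails there. *)

theory Defs
  imports "HOL-Computational_Algebra.Factorial_Ring"
begin

text \<open>
  Semirings are commutative with \<open>1 \<noteq> 0\<close> (class \<^class>\<open>comm_semiring_1\<close>). Only multiplication is
  cancellative in a semidomain; the library class \<^class>\<open>semidom\<close> additionally demands additive
  cancellation and is therefore not used.
\<close>

class semidomain = comm_semiring_1 +
  assumes semidomain_cancel: "a \<noteq> 0 \<Longrightarrow> a * b = a * c \<Longrightarrow> b = c"
begin

subclass semiring_no_zero_divisors_cancel
proof
  fix a b c
  show cancel: "c * a = c * b \<longleftrightarrow> c = 0 \<or> a = b" for a b c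
    using semidomain_cancel by auto
  show "a * c = b * c \<longleftrightarrow> c = 0 \<or> a = b"
    using cancel[of c a b] by (simp add: mult_commute)
  show "a \<noteq> 0 \<Longrightarrow> b \<noteq> 0 \<Longrightarrow> a * b \<noteq> 0"
    using semidomain_cancel[of a b 0] by auto
qed

end

context comm_semiring_1
begin

definition is_ideal :: "'a set \<Rightarrow> bool" where
  "is_ideal I \<longleftrightarrow>
     I \<noteq> {} \<and> (\<forall>a\<in>I. \<forall>b\<in>I. a + b \<in> I) \<and> (\<forall>r. \<forall>a\<in>I. r * a \<in> I)"

definition principal_ideal :: "'a \<Rightarrow> 'a set" where
  "principal_ideal a = {r * a | r. True}"

definition ideal_radical :: "'a set \<Rightarrow> 'a set" where
  "ideal_radical I = {x. \<exists>n::nat. n \<ge> 1 \<and> x ^ n \<in> I}"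

definition multiplicative_subset :: "'a set \<Rightarrow> bool" where
  "multiplicative_subset S \<longleftrightarrow>
     S \<subset> UNIV \<and> 1 \<in> S \<and> (\<forall>s\<in>S. \<forall>t\<in>S. s * t \<in> S)"

definition S_primary :: "'a set \<Rightarrow> 'a set \<Rightarrow> bool" where
  "S_primary S A \<longleftrightarrow>
     is_ideal A \<and> A \<inter> S = {} \<and>
     (\<exists>s\<in>S. \<forall>a b. a * b \<in> A \<longrightarrow> s * a \<in> A \<or> s * b \<in> ideal_radical A)"

definition irreducible_elements :: "'a set" where
  "irreducible_elements = {p. irreducible p}"

definition irreducible_elements_meeting :: "'a set \<Rightarrow> 'a set" where
  "irreducible_elements_meeting S =
     {p \<in> irreducible_elements. principal_ideal p \<inter> S \<noteq> {}}"

end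

class principal_ideal_semidomain = semidomain +
  assumes ideal_is_principal: "is_ideal I \<Longrightarrow> \<exists>a. I = principal_ideal a"

text \<open>
  The zero ideal is \<open>S\<close>-primary whenever \<open>0 \<notin> S\<close>, but it is never generated by some \<open>v * p ^ n\<close>
  with \<open>p\<close> irreducible and \<open>(v)\<close> meeting \<open>S\<close>. Hence the characterisation of \<open>S\<close>-primary ideals
  can only hold for nonzero ideals.
\<close>

lemma (in semidomain) zero_ideal_S_primary:
  assumes "multiplicative_subset S" and "0 \<notin> S"
  shows "S_primary S {0}"
proof -
  have "s * a \<in> {0} \<or> s * b \<in> ideal_radical {0}" if "a * b \<in> {0}" for s a b
    using that by (auto simp: ideal_radical_def intro!: exI[of _ "1::nat"])
  moreover have "1 \<in> S"
    using assms(1) by (simp add: multiplicative_subset_def)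
  ultimately show ?thesis
    using assms(2) by (auto simp: S_primary_def is_ideal_def)
qed

lemma (in semidomain) zero_ideal_not_generated:
  assumes "0 \<notin> S" and "p \<in> irreducible_elements" and "principal_ideal v \<inter> S \<noteq> {}"
  shows "principal_ideal (v * p ^ n) \<noteq> {0}"
proof
  assume "principal_ideal (v * p ^ n) = {0}"
  moreover have "1 * (v * p ^ n) \<in> principal_ideal (v * p ^ n)"
    unfolding principal_ideal_def by blast
  ultimately have "v * p ^ n = 0"
    by simp
  moreover have "p ^ n \<noteq> 0"
    using assms(2) by (induction n) (auto simp: irreducible_elements_def)
  ultimately have "v = 0"
    by simp
  then show False
    using assms(1,3) by (auto simp: principal_ideal_def)
qed

end

theory Submission
  imports Defs
begin

text \<open>
  Call an element good if it divides an element of \<open>S\<close>. Since divisibility is well-founded, a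
  generator \<open>a\<close> of \<open>A\<close> that is not good has a minimal divisor that is not good, and such a divisor
  is an irreducible \<open>p \<notin> P\<^sub>S\<close>. Split \<open>a = p\<^sup>n c\<close> with \<open>p\<close> not dividing \<open>c\<close>. As \<open>p\<close> is prime, no power
  of \<open>s c\<close> lies in \<open>A\<close>, so \<open>S\<close>-primariness with witness \<open>s\<close> forces \<open>s p\<^sup>n \<in> A\<close>, that is, \<open>c\<close>
  divides \<open>s\<close>.
\<close>

lemma mem_principal_ideal_iff: "x \<in> principal_ideal a \<longleftrightarrow> a dvd x"
  by (auto simp: principal_ideal_def dvd_def mult.commute)

lemma principal_ideal_meets_iff:
  "principal_ideal a \<inter> S \<noteq> {} \<longleftrightarrow> (\<exists>s\<in>S. a dvd s)"
  by (auto simp: mem_principal_ideal_iff)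

text \<open>By cancelling \<open>x\<close>. Its use is the contrapositive: removing a nonunit factor
  from a nonzero element gives a strictly smaller one in the order of
  \<open>wf_proper_dvd\<close>.\<close>

lemma mult_dvd_self_imp_unit:
  fixes x y :: "'a :: semidomain"
  assumes "x * y dvd x" and "x \<noteq> 0"
  shows "y dvd 1"
proof -
  obtain k where "x = x * y * k" using assms(1) by (elim dvdE)
  then have "x * 1 = x * (y * k)" by (simp add: mult.assoc)
  then show ?thesis using assms(2) by (metis dvd_triv_left mult_cancel_left)
qed

text \<open>This is the ascending chain condition. Along a divisor chain the principal ideals
  increase, so their union \<open>I\<close> is an ideal; its generator already lies in one of them,
  and the chain cannot descend properly after that index.\<close>

lemma wf_proper_dvd:
  "wf {(x, y :: 'a :: principal_ideal_semidomain). x dvd y \<and> \<not> y dvd x}"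
  unfolding wf_iff_no_infinite_down_chain
proof
  assume "\<exists>f. \<forall>i. (f (Suc i), f i) \<in> {(x, y :: 'a). x dvd y \<and> \<not> y dvd x}"
  then obtain f :: "nat \<Rightarrow> 'a"
    where step: "f (Suc i) dvd f i" and proper: "\<not> f i dvd f (Suc i)" for i
    by blast
  have chain: "f j dvd f i" if "i \<le> j" for i j
    using that by (induction rule: dec_induct) (auto intro: dvd_trans step)
  define I where "I = {x. \<exists>i. f i dvd x}"
  have "is_ideal I"
    unfolding is_ideal_def
  proof (intro conjI ballI allI)
    show "I \<noteq> {}" by (auto simp: I_def)
    show "r * x \<in> I" if "x \<in> I" for r x
      using that by (auto simp: I_def intro: dvd_mult)
    show "x + y \<in> I" if "x \<in> I" "y \<in> I" for x y
    proof -
      obtain i j where "f i dvd x" "f j dvd y"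
        using \<open>x \<in> I\<close> \<open>y \<in> I\<close> by (auto simp: I_def)
      then have "f (max i j) dvd x" "f (max i j) dvd y"
        by (meson chain dvd_trans max.cobounded1 max.cobounded2)+
      then show ?thesis by (auto simp: I_def intro: dvd_add)
    qed
  qed
  then obtain d where d: "I = principal_ideal d"
    using ideal_is_principal by blast
  then have "d \<in> I" by (simp add: mem_principal_ideal_iff)
  then obtain k where "f k dvd d" by (auto simp: I_def)
  have "f (Suc k) \<in> I" by (auto simp: I_def intro: exI[of _ "Suc k"])
  then have "d dvd f (Suc k)" by (simp add: d mem_principal_ideal_iff)
  with \<open>f k dvd d\<close> show False
    using proper dvd_trans by blast
qed

text \<open>A Bezout argument without subtraction: the ideal generated by \<open>p\<close> and
  \<open>a\<close> has a generator \<open>d\<close> dividing \<open>p\<close>. If \<open>d\<close>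
  were not a unit, it would be an associate of \<open>p\<close>, and \<open>p\<close> would divide
  \<open>a\<close>. Hence 1 is a combination of \<open>p\<close> and \<open>a\<close>; multiply it
  by \<open>b\<close>.\<close>

lemma irreducible_dvd_mult:
  fixes p a b :: "'a :: principal_ideal_semidomain"
  assumes "irreducible p" and "p dvd a * b" and "\<not> p dvd a"
  shows "p dvd b"
proof -
  let ?I = "{x * p + y * a | x y. True}"
  have "is_ideal ?I"
    unfolding is_ideal_def
  proof (intro conjI ballI allI)
    show "?I \<noteq> {}" by blast
    show "r * u \<in> ?I" if "u \<in> ?I" for r u
    proof -
      obtain x y where "u = x * p + y * a" using \<open>u \<in> ?I\<close> by blast
      then have "r * u = (r * x) * p + (r * y) * a" by (simp add: algebra_simps)
      then show ?thesis by blast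
    qed
    show "u + v \<in> ?I" if "u \<in> ?I" "v \<in> ?I" for u v
    proof -
      obtain x y where "u = x * p + y * a" using \<open>u \<in> ?I\<close> by blast
      moreover obtain x' y' where "v = x' * p + y' * a" using \<open>v \<in> ?I\<close> by blast
      ultimately have "u + v = (x + x') * p + (y + y') * a" by (simp add: algebra_simps)
      then show ?thesis by blast
    qed
  qed
  then obtain d where I: "?I = principal_ideal d"
    using ideal_is_principal by blast
  have "p = 1 * p + 0 * a" "a = 0 * p + 1 * a" by simp_all
  then have "p \<in> ?I" "a \<in> ?I" by blast+
  then have "d dvd p" "d dvd a"
    by (simp_all only: I mem_principal_ideal_iff)
  then obtain e where e: "p = d * e" by blast
  have "d dvd 1"
  proof (rule ccontr)
    assume "\<not> d dvd 1"
    then have "e dvd 1" using assms(1) e by (auto simp: irreducible_def)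
    then have "p dvd d"
      using e by (metis dvd_def dvd_refl mult.assoc mult.right_neutral)
    then show False using \<open>d dvd a\<close> assms(3) dvd_trans by blast
  qed
  then have "1 \<in> ?I" by (simp only: I mem_principal_ideal_iff)
  then obtain x y where "1 = x * p + y * a" by blast
  then have "b = (x * p + y * a) * b" by simp
  also have "\<dots> = (x * b) * p + y * (a * b)" by (simp add: algebra_simps)
  finally show ?thesis using assms(2) by (metis dvd_add dvd_mult dvd_triv_right)
qed

lemma irreducible_dvd_power:
  fixes p a :: "'a :: principal_ideal_semidomain"
  assumes "irreducible p" and "p dvd a ^ n"
  shows "p dvd a"
  using assms(2)
proof (induction n)
  case 0
  then show ?case using assms(1) by (simp add: irreducible_def)
next
  case (Suc n)
  then show ?case using irreducible_dvd_mult[OF assms(1)] by (metis power_Suc)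
qed

text \<open>Each induction step strips one factor \<open>p\<close> from \<open>a\<close> by
  primality and cancels it, which is why \<open>a\<close> is generalised.\<close>

lemma irreducible_power_dvd_mult:
  fixes p a b :: "'a :: principal_ideal_semidomain"
  assumes "irreducible p" and "p ^ n dvd a * b" and "\<not> p dvd b"
  shows "p ^ n dvd a"
  using assms(2)
proof (induction n arbitrary: a)
  case (Suc n)
  then have "p dvd b * a"
    by (metis dvd_mult_left mult.commute power_Suc)
  then have "p dvd a" using irreducible_dvd_mult assms(1,3) by blast
  then obtain a' where a': "a = p * a'" by blast
  from Suc.prems obtain k where "p * (a' * b) = p * (p ^ n * k)"
    unfolding a' by (auto simp: dvd_def mult.assoc)
  then have "a' * b = p ^ n * k"
    using assms(1) by (auto simp: irreducible_def)
  then have "p ^ n dvd a'" using Suc.IH by auto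
  then show ?case by (simp add: a' mult_dvd_mono)
qed simp

text \<open>Take a divisor \<open>d\<close> of \<open>a\<close> minimal among those dividing no
  element of \<open>S\<close>. If \<open>d\<close> were a product of two nonunits, both would be
  proper divisors, hence divide some \<open>s\<close> and \<open>t\<close> in \<open>S\<close>, and
  \<open>d\<close> would divide \<open>s * t\<close>. It is not a unit because 1 lies in
  \<open>S\<close>.\<close>

lemma ex_irreducible_dvd_outside:
  fixes a :: "'a :: principal_ideal_semidomain"
  assumes "1 \<in> S" and "\<And>s t. s \<in> S \<Longrightarrow> t \<in> S \<Longrightarrow> s * t \<in> S"
    and "\<not> (\<exists>s\<in>S. a dvd s)" and "a \<noteq> 0"
  obtains p where "irreducible p" and "p dvd a" and "\<not> (\<exists>s\<in>S. p dvd s)"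
proof -
  let ?Q = "{d. d dvd a \<and> \<not> (\<exists>s\<in>S. d dvd s)}"
  have "a \<in> ?Q" using assms(3) by simp
  from wfE_min[OF wf_proper_dvd this] obtain d where d: "d \<in> ?Q"
    and min: "\<And>x. (x, d) \<in> {(x, y). x dvd y \<and> \<not> y dvd x} \<Longrightarrow> x \<notin> ?Q" by blast
  have "d \<noteq> 0" using d assms(4) by auto
  have proper: "\<exists>s\<in>S. x dvd s" if "d = x * y" "\<not> y dvd 1" for x y
  proof -
    have "\<not> d dvd x"
      using mult_dvd_self_imp_unit[of x y] \<open>d \<noteq> 0\<close> that by auto
    then have "x \<notin> ?Q" using min[of x] that(1) by auto
    moreover have "x dvd a" using d that(1) dvd_mult_left by blast
    ultimately show ?thesis by blast
  qed
  have "irreducible d"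
  proof (rule irreducibleI)
    show "\<not> d dvd 1" using d assms(1) by auto
    show "x dvd 1 \<or> y dvd 1" if "d = x * y" for x y
    proof (rule ccontr)
      assume *: "\<not> (x dvd 1 \<or> y dvd 1)"
      then obtain s t where "s \<in> S" "x dvd s" "t \<in> S" "y dvd t"
        using proper[of x y] proper[of y x] \<open>d = x * y\<close> by (metis mult.commute)
      then have "s * t \<in> S" "d dvd s * t"
        using assms(2) \<open>d = x * y\<close> by (simp_all add: mult_dvd_mono)
      then show False using d by blast
    qed
  qed (fact \<open>d \<noteq> 0\<close>)
  then show ?thesis using d that by blast
qed

text \<open>Instead of maximising the exponent, choose the cofactor \<open>c\<close> minimal under
  proper divisibility: if \<open>p\<close> divided \<open>c\<close>, the quotient would be a smaller
  cofactor.\<close>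

lemma irreducible_multiplicity_split:
  fixes p a :: "'a :: principal_ideal_semidomain"
  assumes "irreducible p" and "a \<noteq> 0"
  obtains n c where "a = p ^ n * c" and "\<not> p dvd c"
proof -
  let ?Q = "{c. \<exists>n. a = p ^ n * c}"
  have "a = p ^ 0 * a" by simp
  then have "a \<in> ?Q" by blast
  from wfE_min[OF wf_proper_dvd this] obtain c where "c \<in> ?Q"
    and min: "\<And>x. (x, c) \<in> {(x, y). x dvd y \<and> \<not> y dvd x} \<Longrightarrow> x \<notin> ?Q" by blast
  then obtain n where n: "a = p ^ n * c" by blast
  have "\<not> p dvd c"
  proof
    assume "p dvd c"
    then obtain c' where c': "c = p * c'" by blast
    have "\<not> c dvd c'"
      using mult_dvd_self_imp_unit[of c' p] assms n c'
      by (auto simp: irreducible_def mult.commute)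
    then have "c' \<notin> ?Q" using min[of c'] c' by auto
    moreover have "a = p ^ Suc n * c'" using n c' by (simp add: ac_simps)
    ultimately show False by blast
  qed
  with n show ?thesis using that by blast
qed

theorem theorem3p3:
  fixes S A :: "'a :: principal_ideal_semidomain set"
  assumes "multiplicative_subset S"
    and "is_ideal A"
    and "A \<noteq> {0}"
  shows "S_primary S A \<longleftrightarrow>
    (\<exists>(n::nat) p v. n \<ge> 1 \<and> p \<in> irreducible_elements - irreducible_elements_meeting S \<and>
       principal_ideal v \<inter> S \<noteq> {} \<and> A = principal_ideal (v * p ^ n))"
proof -
  have S: "1 \<in> S" "\<And>s t. s \<in> S \<Longrightarrow> t \<in> S \<Longrightarrow> s * t \<in> S"
    using assms(1) by (auto simp: multiplicative_subset_def)
  have outside: "p \<in> irreducible_elements - irreducible_elements_meeting S \<longleftrightarrow>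
      irreducible p \<and> \<not> (\<exists>s\<in>S. p dvd s)" for p
    unfolding irreducible_elements_meeting_def irreducible_elements_def
    by (auto simp: mem_principal_ideal_iff)
  show ?thesis
    unfolding outside principal_ideal_meets_iff
  proof
    assume prim: "S_primary S A"
    then obtain s where "s \<in> S"
      and s: "\<And>a b. a * b \<in> A \<Longrightarrow> s * a \<in> A \<or> s * b \<in> ideal_radical A"
      unfolding S_primary_def by blast
    obtain a where a: "A = principal_ideal a"
      using ideal_is_principal assms(2) by blast
    \<comment> \<open>Both the choice of \<open>p\<close> and the splitting of \<open>a\<close> rest
      on this: 0 has no cofactor that \<open>p\<close> fails to divide.\<close>
    have "a \<noteq> 0" using assms(3) a by (auto simp: principal_ideal_def)
    have "\<not> (\<exists>s\<in>S. a dvd s)"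
      using prim unfolding S_primary_def a principal_ideal_meets_iff[symmetric] by blast
    then obtain p where p: "irreducible p" "p dvd a" "\<not> (\<exists>s\<in>S. p dvd s)"
      using ex_irreducible_dvd_outside[of S a] S \<open>a \<noteq> 0\<close> by metis
    obtain n c where n: "a = p ^ n * c" and c: "\<not> p dvd c"
      using irreducible_multiplicity_split[OF p(1) \<open>a \<noteq> 0\<close>] by blast
    have "n \<noteq> 0" using n c p(2) by (cases n) auto
    have "s * c \<notin> ideal_radical A"
    proof
      assume "s * c \<in> ideal_radical A"
      then obtain k where "a dvd (s * c) ^ k"
        by (auto simp: ideal_radical_def a mem_principal_ideal_iff)
      then have "p dvd s * c"
        using p(1,2) irreducible_dvd_power dvd_trans by blast
      then show False using irreducible_dvd_mult[OF p(1)] p(3) c \<open>s \<in> S\<close> by blast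
    qed
    then have "a dvd s * p ^ n"
      using s[of "p ^ n" c] n by (simp add: a mem_principal_ideal_iff)
    then obtain k where "s * p ^ n = a * k" by (elim dvdE)
    \<comment> \<open>Cancelling \<open>p ^ n\<close> shows that \<open>c\<close> divides
      \<open>s\<close>, so \<open>c\<close> can serve as \<open>v\<close>.\<close>
    then have "p ^ n * s = p ^ n * (c * k)"
      using n by (simp add: ac_simps)
    moreover have "p ^ n \<noteq> 0" using \<open>a \<noteq> 0\<close> n by auto
    ultimately have "c dvd s" by auto
    then show "\<exists>n p v. 1 \<le> n \<and> (irreducible p \<and> \<not> (\<exists>s\<in>S. p dvd s)) \<and>
        (\<exists>s\<in>S. v dvd s) \<and> A = principal_ideal (v * p ^ n)"
      using \<open>n \<noteq> 0\<close> p \<open>s \<in> S\<close> a n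
      by (intro exI[of _ n] exI[of _ p] exI[of _ c]) (auto simp: mult.commute)
  next
    assume "\<exists>n p v. 1 \<le> n \<and> (irreducible p \<and> \<not> (\<exists>s\<in>S. p dvd s)) \<and>
        (\<exists>s\<in>S. v dvd s) \<and> A = principal_ideal (v * p ^ n)"
    then obtain n p v s where n: "1 \<le> n" and p: "irreducible p" "\<not> (\<exists>s\<in>S. p dvd s)"
      and s: "s \<in> S" "v dvd s" and A: "A = principal_ideal (v * p ^ n)" by blast
    \<comment> \<open>Since the exponent is positive, \<open>p\<close> divides every element of
      \<open>A\<close>, but it divides none of \<open>S\<close>.\<close>
    have "p dvd v * p ^ n" using n by (intro dvd_mult dvd_power) auto
    then have "A \<inter> S = {}"
      using p(2) dvd_trans unfolding A disjoint_iff mem_principal_ideal_iff by blast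
    \<comment> \<open>The multiple \<open>s\<close> of \<open>v\<close> is the witness for being
      \<open>S\<close>-primary. If \<open>p\<close> divides \<open>b\<close>, the exponent
      \<open>n\<close> puts \<open>s * b\<close> in the radical, as \<open>v\<close> divides
      \<open>s ^ n\<close>; otherwise all of \<open>p ^ n\<close> must divide
      \<open>a\<close>.\<close>
    moreover have "s * a \<in> A \<or> s * b \<in> ideal_radical A" if "a * b \<in> A" for a b
    proof (cases "p dvd b")
      case True
      have "v dvd s ^ n" using s(2) n by (metis dvd_power dvd_trans less_le_trans zero_less_one)
      then have "v * p ^ n dvd (s * b) ^ n"
        using True by (simp add: power_mult_distrib mult_dvd_mono dvd_power_same)
      then show ?thesis
        using n by (auto simp: ideal_radical_def A mem_principal_ideal_iff)
    next
      case False
      have "p ^ n dvd a * b"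
        using that by (auto simp: A mem_principal_ideal_iff dest: dvd_mult_right)
      then have "p ^ n dvd a"
        using irreducible_power_dvd_mult p(1) False by blast
      then show ?thesis using s(2) by (simp add: A mem_principal_ideal_iff mult_dvd_mono)
    qed
    ultimately show "S_primary S A"
      using assms(2) s(1) unfolding S_primary_def by blast
  qed
qed

end
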